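(* Let $p$ be a prime, let $s\in\mathbb N$, and let $k,n_1,\ldots,n_s$ be nonnegative integers with $k\leq n_i$ for all $i$. Then $$\int_{\mathbb Z_p}B_{k,n_1}(x)B_{k,n_2}(x)\cdots B_{k,n_s}(x)\,d\mu_1(x)=\binom{n_1}{k}\binom{n_2}{k}\cdots\binom{n_s}{k}\sum_{l=0}^{n_1+\cdots+n_s-sk}\binom{n_1+\cdots+n_s-sk}{l}(-1)^{l}B_{sk+l}.$$
   Context: For integers $0\leq k\leq n$, the Bernstein polynomial is $B_{k,n}(x)=\binom{n}{k}x^k(1-x)^{n-k}$. $\mathbb Z_p$ denotes the ring of $p$-adic integers, and for a uniformly differentiable $f:\mathbb Z_p\to\mathbb C_p$ the bosonic $p$-adic (Volkenborn) integral is $\int_{\mathbb Z_p}f(x)\,d\mu_1(x)=\lim_{N\to\infty}\frac{1}{p^N}\sum_{x=0}^{p^N-1}f(x)$. $B_m$ denotes the $m$-th Bernoulli number, defined by $\frac{t}{e^t-1}=\sum_{m\geq0}B_m\frac{t^m}{m!}$; one has $\int_{\mathbb Z_p}x^m\,d\mu_1(x)=B_m$. *)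

theory Defs
  imports "HOL-Analysis.Analysis" "HOL-Computational_Algebra.Computational_Algebra"
begin

definition padic_abs :: "nat \<Rightarrow> rat \<Rightarrow> real" where
  "padic_abs p q =
     (if q = 0 then 0
      else real p powi (int (multiplicity (int p) (snd (quotient_of q)))
                      - int (multiplicity (int p) (fst (quotient_of q)))))"

text \<open>
  The field \<open>\<complex>\<^sub>p\<close> is the completion of an algebraic closure of \<open>\<rat>\<^sub>p\<close>, where \<open>\<rat>\<^sub>p\<close> is the
  completion of \<open>\<rat>\<close> for the \<open>p\<close>-adic absolute value; this determines it up to isometric
  isomorphism. It is represented by a type that is a field and a complete metric space;
  the absolute value of \<open>x\<close> is \<open>dist x 0\<close>. Inside a complete valued field containing \<open>\<rat>\<close>,
  the completion of \<open>\<rat>\<close> is the topological closure of \<open>\<rat>\<close>.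
\<close>

definition padic_numbers :: "'a::{field_char_0,complete_space} set" where
  "padic_numbers = closure \<rat>"

definition padic_integers :: "'a::{field_char_0,complete_space} set" where
  "padic_integers = {x \<in> padic_numbers. dist x 0 \<le> 1}"

definition padic_algebraic :: "'a::{field_char_0,complete_space} set" where
  "padic_algebraic =
     {x. \<exists>f::'a poly. f \<noteq> 0 \<and> (\<forall>i. coeff f i \<in> padic_numbers) \<and> poly f x = 0}"

text \<open>
  The first three conditions say that the metric comes from an absolute value extending the
  \<open>p\<close>-adic one on \<open>\<rat>\<close>; the last two say that the elements algebraic over \<open>\<rat>\<^sub>p\<close> form an
  algebraic closure of \<open>\<rat>\<^sub>p\<close>, and that the whole (complete) field is its completion.
\<close>

definition is_padic_complex_field :: "nat \<Rightarrow> 'a::{field_char_0,complete_space} itself \<Rightarrow> bool" where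
  "is_padic_complex_field p (_ :: 'a itself) \<longleftrightarrow>
     (\<forall>x y :: 'a. dist x y = dist (x - y) 0) \<and>
     (\<forall>x y :: 'a. dist (x * y) 0 = dist x 0 * dist y 0) \<and>
     (\<forall>q. dist (of_rat q :: 'a) 0 = padic_abs p q) \<and>
     (\<forall>f :: 'a poly. degree f > 0 \<and> (\<forall>i. coeff f i \<in> padic_algebraic)
        \<longrightarrow> (\<exists>x \<in> padic_algebraic. poly f x = 0)) \<and>
     closure (padic_algebraic :: 'a set) = UNIV"

text \<open>
  Functions \<open>\<int>\<^sub>p \<rightarrow> \<complex>\<^sub>p\<close> are functions on \<open>\<complex>\<^sub>p\<close> of which only the values on \<open>\<int>\<^sub>p\<close> matter.
  Uniform differentiability is meant in the usual sense of \<open>p\<close>-adic analysis: at each point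
  \<open>a\<close> the difference quotient \<open>(f x - f y) / (x - y)\<close> has a limit as \<open>(x, y) \<rightarrow> (a, a)\<close>.
\<close>

definition uniformly_differentiable_Zp ::
    "('a::{field_char_0,complete_space} \<Rightarrow> 'a) \<Rightarrow> bool" where
  "uniformly_differentiable_Zp f \<longleftrightarrow>
     (\<forall>a \<in> padic_integers. \<exists>d.
        ((\<lambda>(x, y). (f x - f y) / (x - y)) \<longlongrightarrow> d)
          (at (a, a) within {(x, y). x \<in> padic_integers \<and> y \<in> padic_integers \<and> x \<noteq> y}))"

definition has_volkenborn_integral ::
    "nat \<Rightarrow> ('a::{field_char_0,complete_space} \<Rightarrow> 'a) \<Rightarrow> 'a \<Rightarrow> bool" where
  "has_volkenborn_integral p f I \<longleftrightarrow>
     uniformly_differentiable_Zp f \<and>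
     (\<lambda>N. (1 / of_nat (p ^ N)) * (\<Sum>x = 0..p ^ N - 1. f (of_nat x))) \<longlonglongrightarrow> I"

definition bernstein :: "nat \<Rightarrow> nat \<Rightarrow> 'a::comm_ring_1 \<Rightarrow> 'a" where
  "bernstein k n x = of_nat (n choose k) * x ^ k * (1 - x) ^ (n - k)"

definition bernoulli :: "nat \<Rightarrow> rat" where
  "bernoulli m = fact m * fps_nth (fps_X / (fps_exp 1 - 1)) m"

lemma bernoulli_egf:
  "Abs_fps (\<lambda>m. bernoulli m / fact m) * (fps_exp 1 - 1) = fps_X"
proof -
  have ne: "fps_exp (1::rat) - 1 \<noteq> 0"
  proof
    assume "fps_exp (1::rat) - 1 = 0"
    then have "fps_nth (fps_exp (1::rat) - 1) 1 = 0" by simp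
    then show False by simp
  qed
  have "subdegree (fps_exp (1::rat) - 1) = 1"
    by (rule subdegreeI) auto
  then have "fps_exp (1::rat) - 1 dvd fps_X"
    using ne by (simp add: fps_dvd_iff)
  moreover have "Abs_fps (\<lambda>m. bernoulli m / fact m) = fps_X / (fps_exp 1 - 1)"
    by (rule fps_ext) (simp add: bernoulli_def)
  ultimately show ?thesis by simp
qed

end

theory Submission
  imports Defs
begin

text \<open>
  Multiplying \<open>t = B(t) (e\<^sup>t - 1)\<close> by the sum of \<open>e\<^bsup>xt\<^esup>\<close> over \<open>x < n\<close> telescopes to
  Faulhaber's formula, which shows that the mean of \<open>x\<^sup>m\<close> over \<open>x < n\<close> is a polynomial in \<open>n\<close>
  with constant term \<open>B\<^sub>m\<close>. Along \<open>n = p\<^sup>N \<rightarrow> 0\<close> it tends to \<open>B\<^sub>m\<close>. The product of Bernstein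
  polynomials is a multiple of \<open>x\<^bsup>sk\<^esup> (1 - x)\<^bsup>\<Sum>n - sk\<^esup>\<close>; expand it binomially and
  integrate term by term.
\<close>

lemma faulhaber_mean:
  assumes "n > 0"
  shows "(\<Sum>x<n. of_nat x ^ m) / of_nat n =
    (\<Sum>j\<le>m. fact m * bernoulli j / (fact j * fact (Suc m - j)) * of_nat n ^ (m - j))"
proof -
  define E where "E = fps_exp (1::rat)"
  define B where "B = Abs_fps (\<lambda>m. bernoulli m / fact m)"
  have pow: "E ^ x = fps_exp (of_nat x)" for x
    by (simp add: E_def fps_exp_power_mult)
  have "fps_X * (\<Sum>x<n. E ^ x) = B * ((E - 1) * (\<Sum>x<n. E ^ x))"
    using bernoulli_egf by (simp add: B_def E_def mult.assoc[symmetric])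
  also have "\<dots> = B * (E ^ n - 1)"
    by (simp only: power_diff_1_eq)
  \<comment> \<open>Compare coefficients of t^(m+1): the factor t shifts the left side, so that the
    m-th power sum appears there.\<close>
  finally have "fps_nth (fps_X * (\<Sum>x<n. E ^ x)) (Suc m) = fps_nth (B * (E ^ n - 1)) (Suc m)"
    by simp
  moreover have "fps_nth (fps_X * (\<Sum>x<n. E ^ x)) (Suc m) = (\<Sum>x<n. of_nat x ^ m / fact m)"
    by (simp add: pow fps_sum_nth)
  ultimately have "(\<Sum>x<n. of_nat x ^ m / fact m) =
      (\<Sum>j\<le>Suc m. bernoulli j / fact j * fps_nth (fps_exp (of_nat n) - 1) (Suc m - j))"
    by (simp add: pow fps_mult_nth B_def atLeast0AtMost del: sum.atMost_Suc)
  \<comment> \<open>The term j = m + 1 vanishes because e^(nt) - 1 has no constant term. Every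
    remaining term contains a positive power of n, so division by n leaves a polynomial in
    n.\<close>
  also have "\<dots> = (\<Sum>j\<le>m. bernoulli j / fact j * (of_nat n ^ (Suc m - j) / fact (Suc m - j)))"
    by (auto intro!: sum.cong)
  finally have *: "(\<Sum>x<n. of_nat x ^ m) / fact m =
      (\<Sum>j\<le>m. bernoulli j / fact j * (of_nat n ^ (Suc m - j) / fact (Suc m - j)))"
    by (simp add: sum_divide_distrib)
  have "(\<Sum>x<n. of_nat x ^ m) / of_nat n =
      fact m / of_nat n * ((\<Sum>x<n. of_nat x ^ m) / (fact m :: rat))"
    by simp
  also have "\<dots> = (\<Sum>j\<le>m. fact m * bernoulli j / (fact j * fact (Suc m - j)) * of_nat n ^ (m - j))"
    unfolding * sum_distrib_left using assms
    by (intro sum.cong refl) (simp add: Suc_diff_le field_simps del: fact_Suc)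
  finally show ?thesis .
qed

text \<open>Supplies |p| < 1, which makes p^N tend to 0 in the field.\<close>

lemma padic_abs_prime:
  assumes "prime p"
  shows "padic_abs p (of_nat p) = 1 / real p"
proof -
  have "prime (int p)" "p \<noteq> 0"
    using assms by (auto simp: prime_gt_0_nat)
  moreover have "quotient_of (of_nat p) = (int p, 1)"
    by (metis of_int_of_nat_eq quotient_of_int Rat.of_int_def)
  ultimately show ?thesis
    by (simp add: padic_abs_def multiplicity_self power_int_minus field_simps)
qed

text \<open>The type class gives a field and a metric without relating them; the two assumptions
  make the field operations continuous. The class \<open>real_normed_field\<close> cannot serve
  here, since a real norm forces |p| = p.\<close>

locale absolute_value_metric =
  fixes absv :: "'a::{field_char_0,complete_space} \<Rightarrow> real"
  assumes dist_eq_absv: "dist x y = absv (x - y)"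
    and absv_mult: "absv (x * y) = absv x * absv y"
begin

lemma absv_eq_dist: "absv x = dist x 0"
  by (simp add: dist_eq_absv)

lemma absv_nonneg: "absv x \<ge> 0"
  by (simp add: absv_eq_dist)

lemma absv_minus: "absv (- x) = absv x"
  using dist_eq_absv[of 0 x] by (simp add: absv_eq_dist dist_commute)

lemma absv_triangle: "absv (x + y) \<le> absv x + absv y"
  using dist_triangle2[of x "- y" 0] by (simp add: dist_eq_absv absv_minus)

text \<open>Turns limits in the field into limits of real numbers, where the error estimates are
  carried out.\<close>

lemma tendsto_absv_iff: "(f \<longlongrightarrow> a) F \<longleftrightarrow> ((\<lambda>x. absv (f x - a)) \<longlongrightarrow> 0) F"
  by (subst tendsto_dist_iff) (simp add: dist_eq_absv)

lemma tendsto_add: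
  fixes f g :: "'b \<Rightarrow> 'a"
  assumes "(f \<longlongrightarrow> a) F" "(g \<longlongrightarrow> b) F"
  shows "((\<lambda>x. f x + g x) \<longlongrightarrow> a + b) F"
  unfolding tendsto_absv_iff
proof (rule Lim_null_comparison)
  show "\<forall>\<^sub>F x in F. norm (absv (f x + g x - (a + b))) \<le> absv (f x - a) + absv (g x - b)"
    using absv_triangle by (simp add: absv_nonneg add_diff_add)
  show "((\<lambda>x. absv (f x - a) + absv (g x - b)) \<longlongrightarrow> 0) F"
    using assms unfolding tendsto_absv_iff by (rule tendsto_add_zero)
qed

lemma tendsto_mult:
  fixes f g :: "'b \<Rightarrow> 'a"
  assumes "(f \<longlongrightarrow> a) F" "(g \<longlongrightarrow> b) F"
  shows "((\<lambda>x. f x * g x) \<longlongrightarrow> a * b) F"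
  unfolding tendsto_absv_iff
proof (rule Lim_null_comparison)
  let ?h = "\<lambda>x. absv (f x - a) * absv (g x - b) + absv (f x - a) * absv b
    + absv a * absv (g x - b)"
  have "absv (f x * g x - a * b) \<le> ?h x" for x
  proof -
    \<comment> \<open>Expanding around (a, b) puts an error factor that tends to 0 into each
      summand.\<close>
    have "f x * g x - a * b = (f x - a) * (g x - b) + (f x - a) * b + a * (g x - b)"
      by (simp add: algebra_simps)
    then show ?thesis
      by (smt (verit) absv_triangle absv_mult)
  qed
  then show "\<forall>\<^sub>F x in F. norm (absv (f x * g x - a * b)) \<le> ?h x"
    by (simp add: absv_nonneg)
  show "(?h \<longlongrightarrow> 0) F"
    using assms unfolding tendsto_absv_iff
    by (intro tendsto_add_zero tendsto_mult_zero tendsto_mult_left_zero tendsto_mult_right_zero)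
qed

lemma tendsto_sum:
  fixes f :: "'b \<Rightarrow> 'c \<Rightarrow> 'a"
  assumes "\<And>i. i \<in> I \<Longrightarrow> (f i \<longlongrightarrow> a i) F"
  shows "((\<lambda>x. \<Sum>i\<in>I. f i x) \<longlongrightarrow> (\<Sum>i\<in>I. a i)) F"
  \<comment> \<open>For infinite \<open>I\<close> both sums are 0 by convention, and the limit is
    that of a constant.\<close>
  using assms by (induction I rule: infinite_finite_induct) (auto intro: tendsto_add)

lemma tendsto_power:
  fixes f :: "'b \<Rightarrow> 'a"
  assumes "(f \<longlongrightarrow> a) F"
  shows "((\<lambda>x. f x ^ m) \<longlongrightarrow> a ^ m) F"
  using assms by (induction m) (auto intro: tendsto_mult)

lemma uniformly_differentiable_Zp_cmult:
  assumes "uniformly_differentiable_Zp (f :: 'a \<Rightarrow> 'a)"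
  shows "uniformly_differentiable_Zp (\<lambda>x. c * f x)"
  unfolding uniformly_differentiable_Zp_def
proof
  fix a :: 'a assume "a \<in> padic_integers"
  then obtain d where "((\<lambda>(x, y). (f x - f y) / (x - y)) \<longlongrightarrow> d)
      (at (a, a) within {(x, y). x \<in> padic_integers \<and> y \<in> padic_integers \<and> x \<noteq> y})"
    using assms unfolding uniformly_differentiable_Zp_def by blast
  from tendsto_mult[OF tendsto_const this, of c]
  show "\<exists>d. ((\<lambda>(x, y). (c * f x - c * f y) / (x - y)) \<longlongrightarrow> d)
      (at (a, a) within {(x, y). x \<in> padic_integers \<and> y \<in> padic_integers \<and> x \<noteq> y})"
    by (auto simp: case_prod_unfold right_diff_distrib)
qed

lemma uniformly_differentiable_Zp_sum:
  assumes "\<And>i. i \<in> I \<Longrightarrow> uniformly_differentiable_Zp (f i :: 'a \<Rightarrow> 'a)"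
  shows "uniformly_differentiable_Zp (\<lambda>x. \<Sum>i\<in>I. f i x)"
  unfolding uniformly_differentiable_Zp_def
proof
  fix a :: 'a assume "a \<in> padic_integers"
  then have "\<forall>i\<in>I. \<exists>d. ((\<lambda>(x, y). (f i x - f i y) / (x - y)) \<longlongrightarrow> d)
      (at (a, a) within {(x, y). x \<in> padic_integers \<and> y \<in> padic_integers \<and> x \<noteq> y})"
    using assms unfolding uniformly_differentiable_Zp_def by blast
  from bchoice[OF this] obtain d where "\<forall>i\<in>I. ((\<lambda>(x, y). (f i x - f i y) / (x - y)) \<longlongrightarrow> d i)
      (at (a, a) within {(x, y). x \<in> padic_integers \<and> y \<in> padic_integers \<and> x \<noteq> y})" ..
  then have "((\<lambda>z. \<Sum>i\<in>I. case z of (x, y) \<Rightarrow> (f i x - f i y) / (x - y)) \<longlongrightarrow> (\<Sum>i\<in>I. d i))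
      (at (a, a) within {(x, y). x \<in> padic_integers \<and> y \<in> padic_integers \<and> x \<noteq> y})"
    by (intro tendsto_sum) blast
  then show "\<exists>d. ((\<lambda>(x, y). ((\<Sum>i\<in>I. f i x) - (\<Sum>i\<in>I. f i y)) / (x - y)) \<longlongrightarrow> d)
      (at (a, a) within {(x, y). x \<in> padic_integers \<and> y \<in> padic_integers \<and> x \<noteq> y})"
    by (auto simp: case_prod_unfold sum_subtractf[symmetric] sum_divide_distrib)
qed

text \<open>Off the diagonal, the factorisation of x^m - y^m turns the difference quotient into the
  polynomial \<open>?Q\<close>. This is continuous, so its value at (a, a), namely m * a^(m-1), is
  the limit.\<close>

lemma uniformly_differentiable_Zp_power:
  "uniformly_differentiable_Zp (\<lambda>x::'a. x ^ m)"
  unfolding uniformly_differentiable_Zp_def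
proof
  fix a :: 'a
  let ?F = "at (a, a) within {(x, y). x \<in> padic_integers \<and> y \<in> padic_integers \<and> x \<noteq> y}"
  let ?Q = "\<lambda>z. \<Sum>i<m. snd z ^ (m - Suc i) * fst z ^ i"
  have "((\<lambda>z. z) \<longlongrightarrow> (a, a)) ?F"
    by (rule tendsto_ident_at)
  then have "(?Q \<longlongrightarrow> ?Q (a, a)) ?F"
    by (intro tendsto_sum tendsto_mult tendsto_power tendsto_fst tendsto_snd)
  moreover have "\<forall>\<^sub>F z in ?F. (case z of (x, y) \<Rightarrow> (x ^ m - y ^ m) / (x - y)) = ?Q z"
    unfolding eventually_at_filter
    by (intro always_eventually) (auto simp: power_diff_sumr2)
  ultimately have "((\<lambda>(x, y). (x ^ m - y ^ m) / (x - y)) \<longlongrightarrow> ?Q (a, a)) ?F"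
    by (subst tendsto_cong)
  then show "\<exists>d. ((\<lambda>(x, y). (x ^ m - y ^ m) / (x - y)) \<longlongrightarrow> d) ?F" ..
qed

lemma has_volkenborn_integral_cmult:
  assumes "has_volkenborn_integral p (f :: 'a \<Rightarrow> 'a) I"
  shows "has_volkenborn_integral p (\<lambda>x. c * f x) (c * I)"
proof -
  have "(\<lambda>N. c * ((1 / of_nat (p ^ N)) * (\<Sum>x = 0..p ^ N - 1. f (of_nat x)))) \<longlonglongrightarrow> c * I"
    using assms unfolding has_volkenborn_integral_def
    by (intro tendsto_mult tendsto_const) blast
  then show ?thesis
    using assms uniformly_differentiable_Zp_cmult
    by (simp add: has_volkenborn_integral_def sum_distrib_left mult.left_commute)
qed

lemma has_volkenborn_integral_sum:
  assumes "\<And>i. i \<in> A \<Longrightarrow> has_volkenborn_integral p (f i :: 'a \<Rightarrow> 'a) (I i)"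
  shows "has_volkenborn_integral p (\<lambda>x. \<Sum>i\<in>A. f i x) (\<Sum>i\<in>A. I i)"
proof -
  have "(\<lambda>N. \<Sum>i\<in>A. (1 / of_nat (p ^ N)) * (\<Sum>x = 0..p ^ N - 1. f i (of_nat x)))
      \<longlonglongrightarrow> (\<Sum>i\<in>A. I i)"
    using assms unfolding has_volkenborn_integral_def by (intro tendsto_sum) blast
  moreover have "(\<Sum>i\<in>A. (1 / of_nat (p ^ N)) * (\<Sum>x = 0..p ^ N - 1. f i (of_nat x))) =
      (1 / of_nat (p ^ N)) * (\<Sum>x = 0..p ^ N - 1. \<Sum>i\<in>A. f i (of_nat x))" for N
    by (subst sum.swap) (simp only: sum_distrib_left)
  ultimately show ?thesis
    using assms uniformly_differentiable_Zp_sum[of A f]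
    by (simp add: has_volkenborn_integral_def)
qed

text \<open>Taking n = p^N in \<open>faulhaber_mean\<close> makes the N-th mean a polynomial in p^N
  with coefficients \<open>c j\<close>; its limit is the constant term.\<close>

lemma has_volkenborn_integral_power:
  assumes "p > 0" and "absv (of_nat p) < 1"
  shows "has_volkenborn_integral p (\<lambda>x::'a. x ^ m) (of_rat (bernoulli m))"
proof -
  define c where "c j = (of_rat (fact m * bernoulli j / (fact j * fact (Suc m - j))) :: 'a)" for j
  \<comment> \<open>The factor \<open>absv 1\<close> starts the induction at N = 0; being constant,
    it does not affect the limit 0.\<close>
  have absv_power: "absv (of_nat p ^ N) = absv 1 * absv (of_nat p) ^ N" for N
    by (induction N) (auto simp: absv_mult)
  have "(\<lambda>N. of_nat p ^ N :: 'a) \<longlonglongrightarrow> 0"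
    unfolding tendsto_absv_iff using assms(2)
    by (auto simp: absv_power absv_nonneg intro!: tendsto_mult_right_zero LIMSEQ_power_zero)
  then have "(\<lambda>N. \<Sum>j\<le>m. c j * (of_nat p ^ N) ^ (m - j)) \<longlonglongrightarrow> (\<Sum>j\<le>m. c j * 0 ^ (m - j))"
    by (intro tendsto_sum tendsto_mult tendsto_power tendsto_const)
  \<comment> \<open>Since 0^0 = 1, exactly the term j = m survives, and \<open>c m\<close> reduces
    to the Bernoulli number.\<close>
  moreover have "(\<Sum>j\<le>m. c j * 0 ^ (m - j)) = (\<Sum>j\<le>m. if j = m then c j else 0)"
    by (intro sum.cong) auto
  then have "(\<Sum>j\<le>m. c j * 0 ^ (m - j)) = of_rat (bernoulli m)"
    by (simp add: c_def)
  moreover have "(1 / of_nat (p ^ N)) * (\<Sum>x = 0..p ^ N - 1. of_nat x ^ m) =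
      (\<Sum>j\<le>m. c j * (of_nat p ^ N) ^ (m - j))" for N
  proof -
    \<comment> \<open>Positivity of p keeps the natural subtraction from truncating.\<close>
    have "{0..p ^ N - 1} = {..<p ^ N}"
      using assms(1) by (auto simp: Suc_le_eq le_less_trans)
    \<comment> \<open>Faulhaber's formula is an identity of rationals; \<open>of_rat\<close>
      transports it to the field.\<close>
    moreover have "(\<Sum>x<p ^ N. of_nat x ^ m) / of_nat (p ^ N) =
        (of_rat ((\<Sum>x<p ^ N. of_nat x ^ m) / of_nat (p ^ N)) :: 'a)"
      by (simp add: of_rat_sum of_rat_divide of_rat_power)
    moreover have "\<dots> = (\<Sum>j\<le>m. c j * (of_nat p ^ N) ^ (m - j))"
      using assms(1)
      by (subst faulhaber_mean) (simp_all add: c_def of_rat_sum of_rat_mult of_rat_divide of_rat_power)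
    ultimately show ?thesis
      by simp
  qed
  ultimately show ?thesis
    unfolding has_volkenborn_integral_def
    using uniformly_differentiable_Zp_power by simp
qed

end

lemma prod_bernstein:
  fixes x :: "'a::comm_ring_1"
  assumes "\<And>i. i \<in> A \<Longrightarrow> k \<le> n i"
  defines "M \<equiv> (\<Sum>i\<in>A. n i) - card A * k"
  shows "(\<Prod>i\<in>A. bernstein k (n i) x) = (\<Prod>i\<in>A. of_nat (n i choose k)) *
    (\<Sum>l=0..M. of_nat (M choose l) * (-1) ^ l * x ^ (card A * k + l))"
proof -
  \<comment> \<open>Because k \<le> n i for each i, the natural subtractions are exact and the
    exponents of 1 - x add up to \<open>M\<close>.\<close>
  have "(\<Sum>i\<in>A. n i - k) = M"
    using assms(1) by (simp add: M_def sum_subtractf_nat)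
  then have "(\<Prod>i\<in>A. bernstein k (n i) x) =
      (\<Prod>i\<in>A. of_nat (n i choose k)) * (x ^ (card A * k) * (1 - x) ^ M)"
    by (simp add: bernstein_def prod.distrib power_sum[symmetric] mult.assoc
        power_mult[symmetric] mult.commute[of k])
  also have "(1 - x) ^ M = (\<Sum>l\<le>M. of_nat (M choose l) * (- x) ^ l)"
    using binomial_ring[of "- x" 1 M] by simp
  also have "x ^ (card A * k) * \<dots> =
      (\<Sum>l=0..M. of_nat (M choose l) * (-1) ^ l * x ^ (card A * k + l))"
    unfolding sum_distrib_left atLeast0AtMost
    by (intro sum.cong refl) (simp add: power_minus[of x] power_add mult_ac)
  finally show ?thesis .
qed

theorem mainTheorem4:
  fixes p s k :: nat and n :: "nat \<Rightarrow> nat"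
  assumes "prime p"
    and "is_padic_complex_field p TYPE('a::{field_char_0,complete_space})"
    and "\<And>i. i \<in> {1..s} \<Longrightarrow> k \<le> n i"
  shows "has_volkenborn_integral p
           (\<lambda>x::'a. \<Prod>i=1..s. bernstein k (n i) x)
           ((\<Prod>i=1..s. of_nat (n i choose k)) *
            (\<Sum>l=0..(\<Sum>i=1..s. n i) - s * k.
               of_nat (((\<Sum>i=1..s. n i) - s * k) choose l) * (-1) ^ l *
               of_rat (bernoulli (s * k + l))))"
proof -
  \<comment> \<open>The locale assumptions are the first two conditions on the field; the third one
    gives |p| next.\<close>
  interpret absolute_value_metric "\<lambda>x::'a. dist x 0"
    using assms(2) unfolding is_padic_complex_field_def by unfold_locales blast+
  have "dist (of_rat (of_nat p) :: 'a) 0 = padic_abs p (of_nat p)"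
    using assms(2) unfolding is_padic_complex_field_def by blast
  then have "dist (of_nat p :: 'a) 0 < 1"
    using padic_abs_prime[OF assms(1)] prime_gt_1_nat[OF assms(1)] by simp
  then have "has_volkenborn_integral p (\<lambda>x::'a. x ^ m) (of_rat (bernoulli m))" for m
    using prime_gt_0_nat[OF assms(1)] by (rule has_volkenborn_integral_power[rotated])
  \<comment> \<open>The integrand is written as a constant times a sum of constants times powers, so
    that linearity reduces it to the integrals of powers.\<close>
  then have "has_volkenborn_integral p
      (\<lambda>x::'a. (\<Prod>i=1..s. of_nat (n i choose k)) *
        (\<Sum>l=0..(\<Sum>i=1..s. n i) - s * k.
          of_nat (((\<Sum>i=1..s. n i) - s * k) choose l) * (-1) ^ l * x ^ (s * k + l)))
      ((\<Prod>i=1..s. of_nat (n i choose k)) *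
        (\<Sum>l=0..(\<Sum>i=1..s. n i) - s * k.
          of_nat (((\<Sum>i=1..s. n i) - s * k) choose l) * (-1) ^ l *
          of_rat (bernoulli (s * k + l))))"
    by (intro has_volkenborn_integral_cmult has_volkenborn_integral_sum)
  then show ?thesis
    using prod_bernstein[where ?'a = 'a, of "{1..s}" k n] assms(3) by simp
qed

end
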